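(* Let $(X,T)$ be a topological dynamical system, i.e. $X$ is a compact metrizable space and $T:X\to X$ is continuous, and let $(\widetilde{X_T},\widetilde{T})$ be its natural extension. Then $$\mathrm{mdim}(X,T)\geq \mathrm{mdim}(\widetilde{X_T}, \widetilde{T}).$$
   Context: Natural extension: $\widetilde{X_T}$ is the set of sequences $(x_k)_{k\in\mathbb{N}}$ with $x_k\in\bigcap_{n\ge0}T^nX$ and $T(x_{k+1})=x_k$ for all $k\in\mathbb{N}$, with the topology induced from $X^{\mathbb{N}}$; $\widetilde{T}$ is the homeomorphism $(x_k)_{k\in\mathbb{N}}\mapsto(Tx_0,x_0,x_1,\dots)$ of $\widetilde{X_T}$. Mean dimension: for a finite open cover $\mathcal{A}$ of a compact space, $\mathrm{ord}(\mathcal{A})=\sup_{x}\sum_{A\in\mathcal{A}}1_A(x)-1$ and $D(\mathcal{A})=\min_{\mathcal{B}\succ\mathcal{A}}\mathrm{ord}(\mathcal{B})$ over finite open covers $\mathcal{B}$ finer than $\mathcal{A}$; $\mathrm{mdim}(X,T)=\sup_{\alpha}\lim_{n\to\infty}\frac1n D(\bigvee_{i=0}^{n-1}T^{-i}\alpha)$, the supremum over finite open covers $\alpha$ of $X$. *)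

theory Defs
  imports "HOL-Analysis.Analysis"
begin

section \<open>Mean dimension\<close>

definition finite_open_cover :: "'a topology \<Rightarrow> 'a set set \<Rightarrow> bool" where
  "finite_open_cover X \<A> \<longleftrightarrow>
     finite \<A> \<and> (\<forall>A\<in>\<A>. openin X A) \<and> \<Union>\<A> = topspace X"

definition finer :: "'a set set \<Rightarrow> 'a set set \<Rightarrow> bool" where
  "finer \<B> \<A> \<longleftrightarrow> (\<forall>B\<in>\<B>. \<exists>A\<in>\<A>. B \<subseteq> A)"

text \<open>The supremum is taken in the natural numbers: for a finite family the multiplicities
  are bounded, so it is a maximum. On the empty space it is 0 and the order is \<open>-1\<close>.\<close>

definition cover_ord :: "'a topology \<Rightarrow> 'a set set \<Rightarrow> int" where
  "cover_ord X \<A> = int (SUP x\<in>topspace X. (\<Sum>A\<in>\<A>. indicator A x)) - 1"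

text \<open>A set of integers that are at least \<open>-1\<close>, nonempty when \<open>\<A>\<close> is a finite open cover;
  hence the infimum is a minimum.\<close>

definition cover_dim :: "'a topology \<Rightarrow> 'a set set \<Rightarrow> int" where
  "cover_dim X \<A> = Inf {cover_ord X \<B> | \<B>. finite_open_cover X \<B> \<and> finer \<B> \<A>}"

definition preimage_cover :: "'a topology \<Rightarrow> ('a \<Rightarrow> 'a) \<Rightarrow> 'a set set \<Rightarrow> 'a set set" where
  "preimage_cover X f \<A> = (\<lambda>A. f -` A \<inter> topspace X) ` \<A>"

definition join_covers :: "'a topology \<Rightarrow> 'i set \<Rightarrow> ('i \<Rightarrow> 'a set set) \<Rightarrow> 'a set set" where
  "join_covers X I \<U> = {topspace X \<inter> (\<Inter>i\<in>I. U i) | U. \<forall>i\<in>I. U i \<in> \<U> i}"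

text \<open>For continuous \<open>T\<close> on a nonempty compact metrizable space the sequence
  \<open>D(\<alpha>\<^sub>n)\<close> is subadditive, where \<open>\<alpha>\<^sub>n\<close> is the join of the first \<open>n\<close> preimages,
  so the limit exists and is finite (Fekete); on the empty space it is 0. The supremum over all covers may be infinite.\<close>

definition mdim :: "'a topology \<Rightarrow> ('a \<Rightarrow> 'a) \<Rightarrow> ereal" where
  "mdim X T =
     (SUP \<alpha>\<in>{\<alpha>. finite_open_cover X \<alpha>}.
        ereal (lim (\<lambda>n. (1 / real n) *
          real_of_int (cover_dim X (join_covers X {0..<n} (\<lambda>i. preimage_cover X (T ^^ i) \<alpha>))))))"

section \<open>Natural extension\<close>

definition natural_ext_set :: "'a topology \<Rightarrow> ('a \<Rightarrow> 'a) \<Rightarrow> (nat \<Rightarrow> 'a) set" where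
  "natural_ext_set X T =
     {x. (\<forall>k. x k \<in> (\<Inter>n. (T ^^ n) ` topspace X)) \<and> (\<forall>k. T (x (Suc k)) = x k)}"

definition natural_ext :: "'a topology \<Rightarrow> ('a \<Rightarrow> 'a) \<Rightarrow> (nat \<Rightarrow> 'a) topology" where
  "natural_ext X T =
     subtopology (product_topology (\<lambda>_. X) UNIV) (natural_ext_set X T)"

definition natural_ext_map :: "('a \<Rightarrow> 'a) \<Rightarrow> (nat \<Rightarrow> 'a) \<Rightarrow> (nat \<Rightarrow> 'a)" where
  "natural_ext_map T x = case_nat (T (x 0)) x"

end

theory Submission
  imports Defs
begin

text \<open>
  Write \<open>E\<close> for the natural extension and \<open>S\<close> for its map. Every coordinate \<open>x \<mapsto> x m\<close> is a
  continuous semiconjugacy from \<open>(E, S)\<close> to \<open>(X, T)\<close>. Pulling a cover \<open>\<alpha>\<close> of \<open>X\<close> back along a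
  semiconjugacy commutes with forming the iterated joins and does not increase \<open>D\<close>, so the
  pullback of \<open>\<alpha>\<close> grows at most as fast as \<open>\<alpha>\<close> itself (\<open>growth_rate_le_of_semiconjugacy\<close>).
  It remains to see that every finite open cover of \<open>E\<close> is refined by such a pullback
  (\<open>natural_ext_cover_refined_by_pullback\<close>). In a point of \<open>E\<close> a late coordinate determines all
  earlier ones, so a basic open set, which constrains finitely many coordinates, already
  constrains a single one; compactness makes one index \<open>m\<close> serve the whole cover. The
  open sets of \<open>X\<close> obtained in this way cover only the image of \<open>E\<close> under the coordinate \<open>m\<close>.
  That image is closed, and its complement, whose pullback is empty, completes the cover of \<open>X\<close>.

  Comparing the growth rates term by term requires both limits in the definition of mean
  dimension to exist. This follows from Fekete's argument (\<open>convergent_subadditive\<close>) once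
  \<open>D\<close> of a common refinement is known to be at most the sum of the two values of \<open>D\<close>
  (\<open>cover_dim_subadditive\<close>). Instead of mapping to nerves and computing the dimension of a
  product of polyhedra, the proof here colours refinements, following Kolmogorov and Ostrand.
  In a normal space a cover with at most \<open>p\<close> sets through each point has, for each \<open>N \<ge> p\<close>,
  refinements consisting of \<open>N\<close> disjoint families such that each point is missed by at most
  \<open>p - 1\<close> of them (\<open>coloured_refinement\<close>). Do this for two covers with bounds \<open>p\<close> and \<open>q\<close> and
  the same \<open>N = p + q - 1\<close>: each point is missed by at most \<open>N - 1\<close> colours in total, so some
  colour reaches it in both. Intersecting equally coloured families gives \<open>N\<close> disjoint families
  that cover the space, hence order at most \<open>N - 1 = (p - 1) + (q - 1)\<close>.
\<close>

section \<open>Separation in normal spaces\<close>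

text \<open>
  Separate each set \<open>F i\<close> from the union of the others by open sets \<open>P i\<close> and \<open>Q i\<close>, and cut \<open>P i\<close>
  down by all \<open>Q j\<close> with \<open>j \<noteq> i\<close>: disjointness of \<open>P i\<close> and \<open>Q i\<close> then separates the \<open>i\<close>-th
  set from each of the others.
\<close>

lemma normal_space_separate_finite_family:
  assumes "normal_space X" and "finite I"
    and F: "\<And>i. i \<in> I \<Longrightarrow> closedin X (F i)" and disj: "disjoint_family_on F I"
    and G: "\<And>i. i \<in> I \<Longrightarrow> openin X (G i)" "\<And>i. i \<in> I \<Longrightarrow> F i \<subseteq> G i"
  obtains W where "\<And>i. i \<in> I \<Longrightarrow> openin X (W i)" "\<And>i. i \<in> I \<Longrightarrow> F i \<subseteq> W i"
    "\<And>i. i \<in> I \<Longrightarrow> W i \<subseteq> G i" "disjoint_family_on W I"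
proof -
  have "\<exists>P Q. openin X P \<and> openin X Q \<and> F i \<subseteq> P \<and> (\<Union>j\<in>I-{i}. F j) \<subseteq> Q \<and> disjnt P Q"
    if "i \<in> I" for i
  proof -
    have "closedin X (\<Union>j\<in>I-{i}. F j)"
      using \<open>finite I\<close> F by (intro closedin_Union) auto
    moreover have "disjnt (F i) (\<Union>j\<in>I-{i}. F j)"
      using disj that by (auto simp: disjoint_family_on_def disjnt_def)
    ultimately show ?thesis
      using \<open>normal_space X\<close> F that unfolding normal_space_def by metis
  qed
  then obtain P Q where P: "\<And>i. i \<in> I \<Longrightarrow> openin X (P i)" "\<And>i. i \<in> I \<Longrightarrow> F i \<subseteq> P i"
    and Q: "\<And>i. i \<in> I \<Longrightarrow> openin X (Q i)" "\<And>i. i \<in> I \<Longrightarrow> (\<Union>j\<in>I-{i}. F j) \<subseteq> Q i"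
    and PQ: "\<And>i. i \<in> I \<Longrightarrow> disjnt (P i) (Q i)"
    by metis
  define W where "W i = G i \<inter> P i \<inter> ((\<Inter>j\<in>I-{i}. Q j) \<inter> topspace X)" for i
  show thesis
  proof
    fix i assume i: "i \<in> I"
    show "openin X (W i)"
    proof -
      have "openin X ((\<Inter>j\<in>I-{i}. Q j) \<inter> topspace X)"
        using Q(1) \<open>finite I\<close> by (intro openin_INT) auto
      then show ?thesis
        using openin_Int[OF openin_Int[OF G(1)[OF i] P(1)[OF i]]] by (simp add: W_def)
    qed
    show "F i \<subseteq> W i"
    proof
      fix x assume x: "x \<in> F i"
      then have "x \<in> Q j" if "j \<in> I - {i}" for j
        using Q(2)[of j] that i by blast
      then show "x \<in> W i"
        using x P(2)[OF i] G(2)[OF i] closedin_subset[OF F[OF i]] by (auto simp: W_def)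
    qed
    show "W i \<subseteq> G i"
      by (auto simp: W_def)
  next
    show "disjoint_family_on W I"
      unfolding disjoint_family_on_def
    proof (intro ballI impI)
      fix i j assume "i \<in> I" "j \<in> I" "i \<noteq> j"
      then have "W i \<subseteq> P i" "W j \<subseteq> Q i" by (auto simp: W_def)
      then show "W i \<inter> W j = {}" using PQ[OF \<open>i \<in> I\<close>] by (auto simp: disjnt_def)
    qed
  qed
qed

text \<open>
  Sort the points outside \<open>G\<close> that lie in exactly \<open>j\<close> of the sets \<open>V i\<close> by the index set \<open>S\<close> of
  those sets. As all points of lower multiplicity lie in \<open>G\<close>, avoiding \<open>G\<close> and all \<open>V i\<close> with
  \<open>i \<notin> S\<close> already forces the index set to be the \<open>j\<close>-element set \<open>S\<close>. The classes are
  therefore closed and pairwise disjoint, and normality separates them.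
\<close>

lemma separate_points_of_multiplicity:
  assumes "normal_space X" and "finite I" and V: "\<forall>i\<in>I. openin X (V i)"
    and "openin X G" and low: "\<forall>x\<in>topspace X. card {i\<in>I. x \<in> V i} < j \<longrightarrow> x \<in> G"
  shows "\<exists>W. (\<forall>S. S \<subseteq> I \<and> card S = j \<longrightarrow> openin X (W S) \<and> (\<forall>i\<in>S. W S \<subseteq> V i)) \<and>
    disjoint_family_on W {S. S \<subseteq> I \<and> card S = j} \<and>
    (\<forall>x\<in>topspace X. card {i\<in>I. x \<in> V i} = j \<and> x \<notin> G \<longrightarrow> x \<in> W {i\<in>I. x \<in> V i})"
proof -
  define J where "J = {S. S \<subseteq> I \<and> card S = j}"
  define F where "F S = topspace X - G - (\<Union>i\<in>I-S. V i)" for S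
  have eq: "{i\<in>I. x \<in> V i} = S" if "S \<in> J" "x \<in> F S" for S x
  proof (rule card_seteq)
    show "finite S" using that \<open>finite I\<close> finite_subset by (auto simp: J_def)
    show "{i\<in>I. x \<in> V i} \<subseteq> S" using that by (auto simp: F_def)
    show "card S \<le> card {i\<in>I. x \<in> V i}"
      using low that by (force simp: J_def F_def not_less)
  qed
  have FJ: "closedin X (F S)" if "S \<in> J" for S
    using V \<open>openin X G\<close> unfolding F_def by (intro closedin_diff openin_Union) auto
  have disj: "disjoint_family_on F J"
    unfolding disjoint_family_on_def using eq by blast
  have "finite J"
    using \<open>finite I\<close> by (simp add: J_def)
  have open_G: "openin X ((\<Inter>i\<in>S. V i) \<inter> topspace X)" if "S \<in> J" for S
    using that V \<open>finite I\<close> finite_subset by (intro openin_INT) (auto simp: J_def)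
  have sub: "F S \<subseteq> (\<Inter>i\<in>S. V i) \<inter> topspace X" if "S \<in> J" for S
    using eq[OF that] by (auto simp: F_def)
  obtain W where W: "\<And>S. S \<in> J \<Longrightarrow> openin X (W S)" "\<And>S. S \<in> J \<Longrightarrow> F S \<subseteq> W S"
    "\<And>S. S \<in> J \<Longrightarrow> W S \<subseteq> (\<Inter>i\<in>S. V i) \<inter> topspace X" "disjoint_family_on W J"
    using normal_space_separate_finite_family
      [OF \<open>normal_space X\<close> \<open>finite J\<close> FJ disj open_G sub] by blast
  have J: "S \<in> J \<longleftrightarrow> S \<subseteq> I \<and> card S = j" for S by (simp add: J_def)
  have cov: "x \<in> W {i\<in>I. x \<in> V i}"
    if "x \<in> topspace X" "card {i\<in>I. x \<in> V i} = j" "x \<notin> G" for x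
  proof -
    have "{i\<in>I. x \<in> V i} \<in> J" "x \<in> F {i\<in>I. x \<in> V i}"
      using that by (auto simp: J F_def)
    then show ?thesis using W(2) by blast
  qed
  have in_V: "W S \<subseteq> V i" if "S \<in> J" "i \<in> S" for S i
    using W(3)[OF that(1)] that(2) by blast
  show ?thesis
    using W(1) in_V W(4) cov J unfolding J_def[symmetric] by (intro exI[of _ W] conjI) blast+
qed

section \<open>Coloured refinements\<close>

definition disjoint_refining :: "'a topology \<Rightarrow> 'a set set \<Rightarrow> 'a set set \<Rightarrow> bool" where
  "disjoint_refining X \<B> \<W> \<longleftrightarrow>
     finite \<W> \<and> (\<forall>W\<in>\<W>. openin X W) \<and> finer \<W> \<B> \<and> disjoint \<W>"

text \<open>
  The families are built by increasing multiplicity: once the points of multiplicity at most \<open>q\<close>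
  are covered, the points of multiplicity \<open>q + 1\<close> that are left can be covered by disjoint open
  sets, one inside each intersection of \<open>q + 1\<close> members of the cover.
\<close>

lemma disjoint_families_cover_low_multiplicity:
  assumes "normal_space X" and \<B>: "finite_open_cover X \<B>"
  shows "\<exists>\<W>. (\<forall>i<q. disjoint_refining X \<B> (\<W> i)) \<and>
    (\<forall>x\<in>topspace X. card {B\<in>\<B>. x \<in> B} \<le> q \<longrightarrow> (\<exists>i<q. x \<in> \<Union>(\<W> i)))"
proof (induction q)
  case 0
  have "card {B\<in>\<B>. x \<in> B} \<noteq> 0" if "x \<in> topspace X" for x
    using that \<B> by (auto simp: finite_open_cover_def)
  then show ?case by auto
next
  case (Suc q)
  then obtain \<W> where \<W>: "\<And>i. i < q \<Longrightarrow> disjoint_refining X \<B> (\<W> i)"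
    and cov: "\<And>x. x \<in> topspace X \<Longrightarrow> card {B\<in>\<B>. x \<in> B} \<le> q \<Longrightarrow> \<exists>i<q. x \<in> \<Union>(\<W> i)"
    by blast
  define G where "G = (\<Union>i<q. \<Union>(\<W> i))"
  have "finite \<B>" and open_\<B>: "\<forall>B\<in>\<B>. openin X B"
    using \<B> by (auto simp: finite_open_cover_def)
  have "openin X G"
    using \<W> by (auto simp: G_def disjoint_refining_def)
  have low: "\<forall>x\<in>topspace X. card {B\<in>\<B>. x \<in> B} < Suc q \<longrightarrow> x \<in> G"
    using cov by (fastforce simp: G_def)
  obtain W where "\<forall>S. S \<subseteq> \<B> \<and> card S = Suc q \<longrightarrow> openin X (W S) \<and> (\<forall>B\<in>S. W S \<subseteq> B)"
    and "disjoint_family_on W {S. S \<subseteq> \<B> \<and> card S = Suc q}"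
    and "\<forall>x\<in>topspace X. card {B\<in>\<B>. x \<in> B} = Suc q \<and> x \<notin> G \<longrightarrow>
      x \<in> W {B\<in>\<B>. x \<in> B}"
    using separate_points_of_multiplicity[where V = "\<lambda>B. B" and j = "Suc q",
      OF \<open>normal_space X\<close> \<open>finite \<B>\<close> open_\<B> \<open>openin X G\<close> low]
    by (elim exE conjE)
  then have W: "\<And>S. S \<subseteq> \<B> \<Longrightarrow> card S = Suc q \<Longrightarrow> openin X (W S)"
    "\<And>S B. S \<subseteq> \<B> \<Longrightarrow> card S = Suc q \<Longrightarrow> B \<in> S \<Longrightarrow> W S \<subseteq> B"
    "disjoint_family_on W {S. S \<subseteq> \<B> \<and> card S = Suc q}"
    "\<And>x. x \<in> topspace X \<Longrightarrow> card {B\<in>\<B>. x \<in> B} = Suc q \<Longrightarrow> x \<notin> G \<Longrightarrow>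
       x \<in> W {B\<in>\<B>. x \<in> B}"
    by blast+
  define \<N> where "\<N> = W ` {S. S \<subseteq> \<B> \<and> card S = Suc q}"
  have "\<exists>B\<in>\<B>. W S \<subseteq> B" if "S \<subseteq> \<B>" "card S = Suc q" for S
    using W(2)[OF that] that by (metis card.empty ex_in_conv nat.distinct(1) subsetD)
  then have "disjoint_refining X \<B> \<N>"
    using \<open>finite \<B>\<close> W(1) W(3)
    unfolding disjoint_refining_def finer_def \<N>_def
    by (auto simp: disjoint_family_on_disjoint_image)
  moreover have "\<exists>i<Suc q. x \<in> \<Union>((\<W>(q := \<N>)) i)"
    if "x \<in> topspace X" "card {B\<in>\<B>. x \<in> B} \<le> Suc q" for x
  proof (cases "x \<in> G")
    case True
    then obtain i where "i < q" "x \<in> \<Union>(\<W> i)" by (auto simp: G_def)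
    then show ?thesis by (intro exI[of _ i]) auto
  next
    case False
    then have c: "card {B\<in>\<B>. x \<in> B} = Suc q"
      using low that by force
    then have "x \<in> W {B\<in>\<B>. x \<in> B}"
      using W(4) that(1) False by blast
    moreover have "W {B\<in>\<B>. x \<in> B} \<in> \<N>"
      unfolding \<N>_def using c by blast
    ultimately show ?thesis
      by (intro exI[of _ q]) auto
  qed
  ultimately show ?case
    using \<W> by (intro exI[of _ "\<W>(q := \<N>)"]) (auto simp: less_Suc_eq)
qed

text \<open>
  The first \<open>p\<close> families cover the space. To add family number \<open>N + 1\<close>, only the points that lie in
  exactly \<open>N + 1 - p\<close> of the families need attention. They are separated according to the set \<open>S\<close>
  of families that contain them, and inside each of the separating sets the new family copies one
  of the families in \<open>S\<close>; a new member thus lies in an old one and still refines the cover.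
\<close>

lemma coloured_refinement:
  assumes "normal_space X" and \<B>: "finite_open_cover X \<B>"
    and mult: "\<And>x. x \<in> topspace X \<Longrightarrow> card {B\<in>\<B>. x \<in> B} \<le> p"
    and "p \<le> N"
  shows "\<exists>\<W>. (\<forall>i<N. disjoint_refining X \<B> (\<W> i)) \<and>
    (\<forall>x\<in>topspace X. N + 1 - p \<le> card {i\<in>{..<N}. x \<in> \<Union>(\<W> i)})"
  using \<open>p \<le> N\<close>
proof (induction N rule: dec_induct)
  case base
  obtain \<W> where \<W>: "\<forall>i<p. disjoint_refining X \<B> (\<W> i)"
    and cov: "\<forall>x\<in>topspace X. card {B\<in>\<B>. x \<in> B} \<le> p \<longrightarrow> (\<exists>i<p. x \<in> \<Union>(\<W> i))"
    using disjoint_families_cover_low_multiplicity[OF assms(1,2)] by blast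
  have "1 \<le> card {i\<in>{..<p}. x \<in> \<Union>(\<W> i)}" if "x \<in> topspace X" for x
  proof -
    have "{i\<in>{..<p}. x \<in> \<Union>(\<W> i)} \<noteq> {}"
      using cov mult that by blast
    then show ?thesis
      by (simp add: Suc_le_eq card_gt_0_iff)
  qed
  then show ?case using \<W> by auto
next
  case (step N)
  then obtain \<W> where \<W>: "\<And>i. i < N \<Longrightarrow> disjoint_refining X \<B> (\<W> i)"
    and many: "\<And>x. x \<in> topspace X \<Longrightarrow> N + 1 - p \<le> card {i\<in>{..<N}. x \<in> \<Union>(\<W> i)}"
    by blast
  define j where "j = N + 1 - p"
  have "j \<ge> 1" using step by (simp add: j_def)
  have openV: "\<forall>i\<in>{..<N}. openin X (\<Union>(\<W> i))"
    using \<W> by (auto simp: disjoint_refining_def)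
  have low: "\<forall>x\<in>topspace X. card {i\<in>{..<N}. x \<in> \<Union>(\<W> i)} < j \<longrightarrow> x \<in> {}"
    using many by (simp add: j_def not_less)
  obtain W where "\<forall>S. S \<subseteq> {..<N} \<and> card S = j \<longrightarrow> openin X (W S) \<and> (\<forall>i\<in>S. W S \<subseteq> \<Union>(\<W> i))"
    and "disjoint_family_on W {S. S \<subseteq> {..<N} \<and> card S = j}"
    and "\<forall>x\<in>topspace X. card {i\<in>{..<N}. x \<in> \<Union>(\<W> i)} = j \<and> x \<notin> {} \<longrightarrow>
      x \<in> W {i\<in>{..<N}. x \<in> \<Union>(\<W> i)}"
    using separate_points_of_multiplicity[where V = "\<lambda>i. \<Union>(\<W> i)" and j = j,
      OF \<open>normal_space X\<close> finite_lessThan openV openin_empty low]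
    by (elim exE conjE)
  then have W: "\<And>S. S \<subseteq> {..<N} \<Longrightarrow> card S = j \<Longrightarrow> openin X (W S)"
    "\<And>S i. S \<subseteq> {..<N} \<Longrightarrow> card S = j \<Longrightarrow> i \<in> S \<Longrightarrow> W S \<subseteq> \<Union>(\<W> i)"
    "disjoint_family_on W {S. S \<subseteq> {..<N} \<and> card S = j}"
    "\<And>x. x \<in> topspace X \<Longrightarrow> card {i\<in>{..<N}. x \<in> \<Union>(\<W> i)} = j \<Longrightarrow>
       x \<in> W {i\<in>{..<N}. x \<in> \<Union>(\<W> i)}"
    by blast+
  define J where "J = {S. S \<subseteq> {..<N} \<and> card S = j}"
  have "finite J" by (simp add: J_def)
  have Min: "Min S \<in> S" "Min S < N" if "S \<in> J" for S
  proof -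
    have "finite S" "S \<noteq> {}" using that \<open>j \<ge> 1\<close> finite_subset[of S "{..<N}"] by (auto simp: J_def)
    then show "Min S \<in> S" by simp
    then show "Min S < N" using that by (auto simp: J_def)
  qed
  \<comment> \<open>Any choice of a colour in \<open>S\<close> would do; \<open>S\<close> is nonempty because \<open>j \<ge> 1\<close>.\<close>
  define \<N> where "\<N> = (\<Union>S\<in>J. (\<lambda>U. W S \<inter> U) ` \<W> (Min S))"
  have "finite \<N>"
    using \<open>finite J\<close> \<W> Min(2) by (auto simp: \<N>_def disjoint_refining_def)
  moreover have "openin X (W S \<inter> U)" if "S \<in> J" "U \<in> \<W> (Min S)" for S U
    using \<W>[OF Min(2)[OF that(1)]] W(1)[of S] that
    by (intro openin_Int) (auto simp: disjoint_refining_def J_def)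
  then have "\<forall>U\<in>\<N>. openin X U"
    by (auto simp: \<N>_def)
  moreover have "finer \<N> \<B>"
    unfolding finer_def
  proof
    fix A assume "A \<in> \<N>"
    then obtain S U where S: "S \<in> J" "U \<in> \<W> (Min S)" "A = W S \<inter> U"
      by (auto simp: \<N>_def)
    then obtain B where "B \<in> \<B>" "U \<subseteq> B"
      using \<W>[OF Min(2)[OF S(1)]] by (auto simp: disjoint_refining_def finer_def)
    then show "\<exists>B\<in>\<B>. A \<subseteq> B" using S by blast
  qed
  moreover have "disjoint \<N>"
  proof (rule pairwiseI)
    fix A A' assume "A \<in> \<N>" "A' \<in> \<N>" and ne: "A \<noteq> A'"
    then obtain S U S' U' where S: "S \<in> J" "U \<in> \<W> (Min S)" "A = W S \<inter> U"
      and S': "S' \<in> J" "U' \<in> \<W> (Min S')" "A' = W S' \<inter> U'"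
      by (auto simp: \<N>_def)
    show "disjnt A A'"
    proof (cases "S = S'")
      case True
      then have "disjnt U U'"
        using \<W>[OF Min(2)[OF S(1)]] S S' ne
        by (auto simp: disjoint_refining_def pairwise_def)
      then show ?thesis using S S' by (auto simp: disjnt_def)
    next
      case False
      then have "W S \<inter> W S' = {}"
        using W(3) S(1) S'(1) by (auto simp: disjoint_family_on_def J_def)
      then show ?thesis using S S' by (auto simp: disjnt_def)
    qed
  qed
  ultimately have \<N>: "disjoint_refining X \<B> \<N>"
    by (simp add: disjoint_refining_def)
  define \<W>' where "\<W>' = \<W>(N := \<N>)"
  have "Suc N + 1 - p \<le> card {i\<in>{..<Suc N}. x \<in> \<Union>(\<W>' i)}" if x: "x \<in> topspace X" for x
  proof -
    define S where "S = {i\<in>{..<N}. x \<in> \<Union>(\<W> i)}"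
    have sub: "S \<subseteq> {i\<in>{..<Suc N}. x \<in> \<Union>(\<W>' i)}"
      by (auto simp: S_def \<W>'_def)
    show ?thesis
    proof (cases "card S = j")
      case True
      then have xW: "x \<in> W S"
        using W(4)[OF x] by (simp add: S_def)
      have SJ: "S \<in> J" using True by (auto simp: J_def S_def)
      then have "x \<in> \<Union>(\<W> (Min S))"
        using W(2)[of S "Min S"] Min(1) xW by (auto simp: J_def)
      then have "x \<in> \<Union>\<N>"
        using SJ xW by (auto simp: \<N>_def)
      then have "insert N S \<subseteq> {i\<in>{..<Suc N}. x \<in> \<Union>(\<W>' i)}"
        using sub by (auto simp: \<W>'_def)
      then have "card (insert N S) \<le> card {i\<in>{..<Suc N}. x \<in> \<Union>(\<W>' i)}"
        by (intro card_mono) auto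
      moreover have "card (insert N S) = Suc j"
        using True by (simp add: S_def)
      ultimately show ?thesis using step by (simp add: j_def)
    next
      case False
      then have "Suc j \<le> card S"
        using many[OF x] by (simp add: S_def j_def)
      also have "\<dots> \<le> card {i\<in>{..<Suc N}. x \<in> \<Union>(\<W>' i)}"
        using sub by (intro card_mono) auto
      finally show ?thesis using step by (simp add: j_def)
    qed
  qed
  then show ?case
    using \<W> \<N> by (intro exI[of _ \<W>']) (auto simp: \<W>'_def less_Suc_eq)
qed

section \<open>Subadditivity of the dimension of covers\<close>

text \<open>
  Bounds on orders are written as \<open>k - 1\<close> with a natural number \<open>k\<close>: then \<open>k\<close> bounds the
  multiplicities, and \<open>k = 0\<close> includes the order \<open>-1\<close> on the empty space.
\<close>

lemma cover_ord_le_iff: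
  assumes "finite \<A>"
  shows "cover_ord X \<A> \<le> int k - 1 \<longleftrightarrow> (\<forall>x\<in>topspace X. card {A\<in>\<A>. x \<in> A} \<le> k)"
proof -
  let ?f = "\<lambda>x. \<Sum>A\<in>\<A>. indicator A x :: nat"
  have f: "?f x = card {A\<in>\<A>. x \<in> A}" for x
    using assms by (simp add: indicator_def sum.If_cases Int_def)
  show ?thesis
  proof (cases "topspace X = {}")
    case False
    have "bdd_above (?f ` topspace X)"
      using assms by (intro bdd_aboveI[of _ "card \<A>"]) (auto simp: f intro: card_mono)
    then have "(SUP x\<in>topspace X. ?f x) \<le> k \<longleftrightarrow> (\<forall>x\<in>topspace X. ?f x \<le> k)"
      using False by (simp add: cSUP_le_iff)
    then show ?thesis
      by (simp only: cover_ord_def f of_nat_le_iff diff_le_eq diff_add_cancel)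
  qed (simp add: cover_ord_def)
qed

lemma bdd_below_cover_ord: "bdd_below {cover_ord X \<B> | \<B>. P \<B>}"
  by (rule bdd_belowI[of _ "-1"]) (auto simp: cover_ord_def)

lemma cover_dim_le:
  assumes "finite_open_cover X \<B>" and "finer \<B> \<A>"
    and "\<And>x. x \<in> topspace X \<Longrightarrow> card {B\<in>\<B>. x \<in> B} \<le> k"
  shows "cover_dim X \<A> \<le> int k - 1"
proof -
  have "cover_dim X \<A> \<le> cover_ord X \<B>"
    unfolding cover_dim_def using assms by (intro cInf_lower bdd_below_cover_ord) auto
  also have "\<dots> \<le> int k - 1"
    using assms by (subst cover_ord_le_iff) (auto simp: finite_open_cover_def)
  finally show ?thesis .
qed

lemma cover_dim_attained:
  assumes "finite_open_cover X \<A>" and le: "cover_dim X \<A> \<le> int k - 1"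
  obtains \<B> where "finite_open_cover X \<B>" "finer \<B> \<A>"
    "\<And>x. x \<in> topspace X \<Longrightarrow> card {B\<in>\<B>. x \<in> B} \<le> k"
proof -
  have "cover_ord X \<A> \<in> {cover_ord X \<B> | \<B>. finite_open_cover X \<B> \<and> finer \<B> \<A>}"
    using assms by (auto simp: finer_def)
  moreover have "cover_dim X \<A> < int k" using le by simp
  ultimately obtain \<B> where \<B>: "finite_open_cover X \<B>" "finer \<B> \<A>" "cover_ord X \<B> < int k"
    unfolding cover_dim_def using cInf_lessD by (smt (verit) empty_iff mem_Collect_eq)
  then have "\<forall>x\<in>topspace X. card {B\<in>\<B>. x \<in> B} \<le> k"
    using cover_ord_le_iff[of \<B> X k] by (auto simp: finite_open_cover_def)
  with \<B> that show thesis by blast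
qed

lemma cover_dim_ge_minus_1:
  assumes "finite_open_cover X \<A>"
  shows "-1 \<le> cover_dim X \<A>"
  unfolding cover_dim_def
proof (rule cInf_greatest)
  show "{cover_ord X \<B> | \<B>. finite_open_cover X \<B> \<and> finer \<B> \<A>} \<noteq> {}"
    using assms by (auto simp: finer_def)
qed (auto simp: cover_ord_def)

lemma cover_dim_nonneg:
  assumes \<A>: "finite_open_cover X \<A>" and ne: "topspace X \<noteq> {}"
  shows "0 \<le> cover_dim X \<A>"
proof (rule ccontr)
  assume "\<not> 0 \<le> cover_dim X \<A>"
  then have "cover_dim X \<A> \<le> int 0 - 1" by simp
  then obtain \<B> where \<B>: "finite_open_cover X \<B>"
    and "\<And>x. x \<in> topspace X \<Longrightarrow> card {B\<in>\<B>. x \<in> B} \<le> 0"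
    using cover_dim_attained[OF \<A>] by metis
  with ne show False
    by (fastforce simp: finite_open_cover_def)
qed

lemma cover_dim_empty:
  assumes "finite_open_cover X \<A>" and "topspace X = {}"
  shows "cover_dim X \<A> = -1"
proof -
  have "cover_dim X \<A> \<le> int 0 - 1"
    using assms by (intro cover_dim_le[of X \<A>]) (auto simp: finer_def)
  with cover_dim_ge_minus_1[OF assms(1)] show ?thesis by simp
qed

lemma openin_vimage:
  assumes "continuous_map X Y f" and "openin Y U"
  shows "openin X (f -` U \<inter> topspace X)"
proof -
  have "f -` U \<inter> topspace X = {x \<in> topspace X. f x \<in> U}" by auto
  then show ?thesis using openin_continuous_map_preimage[OF assms] by simp
qed

lemma cover_dim_le_continuous_preimage:
  assumes f: "continuous_map Y X f" and \<A>: "finite_open_cover X \<A>"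
    and fin: "\<And>A. A \<in> \<A> \<Longrightarrow> \<exists>C\<in>\<C>. f -` A \<inter> topspace Y \<subseteq> C"
  shows "cover_dim Y \<C> \<le> cover_dim X \<A>"
proof -
  define k where "k = nat (cover_dim X \<A> + 1)"
  have k: "cover_dim X \<A> = int k - 1"
    using cover_dim_ge_minus_1[OF \<A>] by (simp add: k_def)
  obtain \<B> where \<B>: "finite_open_cover X \<B>" "finer \<B> \<A>"
    and mult: "\<And>x. x \<in> topspace X \<Longrightarrow> card {B\<in>\<B>. x \<in> B} \<le> k"
    using cover_dim_attained[OF \<A>, of k] k by auto
  let ?P = "(\<lambda>B. f -` B \<inter> topspace Y) ` \<B>"
  have fY: "f y \<in> topspace X" if "y \<in> topspace Y" for y
    using f that continuous_map_image_subset_topspace by blast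
  have "cover_dim Y \<C> \<le> int k - 1"
  proof (rule cover_dim_le[of Y ?P])
    have "openin Y (f -` B \<inter> topspace Y)" if "B \<in> \<B>" for B
      using that \<B> by (intro openin_vimage[OF f]) (auto simp: finite_open_cover_def)
    then show "finite_open_cover Y ?P"
      using \<B> fY by (fastforce simp: finite_open_cover_def)
    show "finer ?P \<C>"
      unfolding finer_def
    proof
      fix Q assume "Q \<in> ?P"
      then obtain B where B: "B \<in> \<B>" "Q = f -` B \<inter> topspace Y" by blast
      then obtain A where "A \<in> \<A>" "B \<subseteq> A" using \<B> by (auto simp: finer_def)
      then show "\<exists>C\<in>\<C>. Q \<subseteq> C" using fin[of A] B by blast
    qed
    fix y assume y: "y \<in> topspace Y"
    have "{Q\<in>?P. y \<in> Q} \<subseteq> (\<lambda>B. f -` B \<inter> topspace Y) ` {B\<in>\<B>. f y \<in> B}"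
      by auto
    then have "card {Q\<in>?P. y \<in> Q} \<le> card {B\<in>\<B>. f y \<in> B}"
      using \<B> by (intro surj_card_le) (auto simp: finite_open_cover_def)
    also have "\<dots> \<le> k" using mult fY y by blast
    finally show "card {Q\<in>?P. y \<in> Q} \<le> k" .
  qed
  then show ?thesis using k by simp
qed

text \<open>
  Colour refinements of \<open>\<A>\<close> and \<open>\<B>\<close> with the same number of colours and intersect members
  of equal colour. On the empty space \<open>D\<close> is always \<open>-1\<close> and subadditivity fails. The family \<open>\<C>\<close> may be anything refined by the
  pairwise intersections, so that it can be an iterated join.
\<close>

lemma cover_dim_subadditive:
  assumes "normal_space X" and ne: "topspace X \<noteq> {}"
    and \<A>: "finite_open_cover X \<A>" and \<B>: "finite_open_cover X \<B>"
    and join: "\<And>A B. A \<in> \<A> \<Longrightarrow> B \<in> \<B> \<Longrightarrow> \<exists>C\<in>\<C>. A \<inter> B \<subseteq> C"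
  shows "cover_dim X \<C> \<le> cover_dim X \<A> + cover_dim X \<B>"
proof -
  define p q where "p = nat (cover_dim X \<A> + 1)" and "q = nat (cover_dim X \<B> + 1)"
  have p: "cover_dim X \<A> = int p - 1" "1 \<le> p" and q: "cover_dim X \<B> = int q - 1" "1 \<le> q"
    using cover_dim_nonneg[OF \<A> ne] cover_dim_nonneg[OF \<B> ne] by (auto simp: p_def q_def)
  obtain \<A>' where \<A>': "finite_open_cover X \<A>'" "finer \<A>' \<A>"
    "\<And>x. x \<in> topspace X \<Longrightarrow> card {B\<in>\<A>'. x \<in> B} \<le> p"
    using cover_dim_attained[OF \<A>, of p] p by auto
  obtain \<B>' where \<B>': "finite_open_cover X \<B>'" "finer \<B>' \<B>"
    "\<And>x. x \<in> topspace X \<Longrightarrow> card {B\<in>\<B>'. x \<in> B} \<le> q"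
    using cover_dim_attained[OF \<B>, of q] q by auto
  define N where "N = p + q - 1"
  have "p \<le> N" "q \<le> N" using p q by (auto simp: N_def)
  obtain U where U: "\<And>i. i < N \<Longrightarrow> disjoint_refining X \<A>' (U i)"
    and Ucard: "\<And>x. x \<in> topspace X \<Longrightarrow> N + 1 - p \<le> card {i\<in>{..<N}. x \<in> \<Union>(U i)}"
    using coloured_refinement[OF \<open>normal_space X\<close> \<A>'(1,3) \<open>p \<le> N\<close>] by blast
  obtain V where V: "\<And>i. i < N \<Longrightarrow> disjoint_refining X \<B>' (V i)"
    and Vcard: "\<And>x. x \<in> topspace X \<Longrightarrow> N + 1 - q \<le> card {i\<in>{..<N}. x \<in> \<Union>(V i)}"
    using coloured_refinement[OF \<open>normal_space X\<close> \<B>'(1,3) \<open>q \<le> N\<close>] by blast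
  define \<D> where "\<D> i = (\<lambda>(A, B). A \<inter> B) ` (U i \<times> V i)" for i
  have "cover_dim X \<C> \<le> int N - 1"
  proof (rule cover_dim_le[of X "\<Union>i<N. \<D> i"])
    \<comment> \<open>\<open>x\<close> has at least \<open>N + 1 - p = q\<close> colours in \<open>U\<close> and at least \<open>p\<close> in \<open>V\<close>, and
      \<open>q + p > N\<close>, so it has a colour in common.\<close>
    have "\<exists>i<N. x \<in> \<Union>(U i) \<and> x \<in> \<Union>(V i)" if x: "x \<in> topspace X" for x
    proof (rule ccontr)
      let ?I = "{i\<in>{..<N}. x \<in> \<Union>(U i)}" and ?J = "{i\<in>{..<N}. x \<in> \<Union>(V i)}"
      assume "\<not> ?thesis"
      then have "?I \<inter> ?J = {}" by blast
      then have "card ?I + card ?J = card (?I \<union> ?J)"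
        by (simp add: card_Un_disjoint)
      also have "\<dots> \<le> card {..<N}" by (intro card_mono) auto
      finally have "card ?I + card ?J \<le> N" by simp
      then show False using Ucard[OF x] Vcard[OF x] p q by (simp add: N_def)
    qed
    then have cov: "topspace X \<subseteq> \<Union>(\<Union>i<N. \<D> i)"
      by (fastforce simp: \<D>_def)
    have "openin X D" if "D \<in> \<D> i" "i < N" for D i
      using U[OF that(2)] V[OF that(2)] that(1) by (auto simp: \<D>_def disjoint_refining_def)
    moreover have fin_\<D>: "finite (\<D> i)" if "i < N" for i
      using U[OF that] V[OF that] by (auto simp: \<D>_def disjoint_refining_def)
    ultimately show "finite_open_cover X (\<Union>i<N. \<D> i)"
      using cov fin_\<D> by (auto simp: finite_open_cover_def dest: openin_subset)
    show "finer (\<Union>i<N. \<D> i) \<C>"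
      unfolding finer_def
    proof
      fix D assume "D \<in> (\<Union>i<N. \<D> i)"
      then obtain i A B where i: "i < N" "A \<in> U i" "B \<in> V i" "D = A \<inter> B"
        by (auto simp: \<D>_def)
      obtain A' where "A' \<in> \<A>" "A \<subseteq> A'"
        using U[OF i(1)] \<A>'(2) i(2) unfolding disjoint_refining_def finer_def by (meson order_trans)
      moreover obtain B' where "B' \<in> \<B>" "B \<subseteq> B'"
        using V[OF i(1)] \<B>'(2) i(3) unfolding disjoint_refining_def finer_def by (meson order_trans)
      ultimately show "\<exists>C\<in>\<C>. D \<subseteq> C"
        using join[of A' B'] i(4) by blast
    qed
    fix x
    have one: "card {D\<in>\<D> i. x \<in> D} \<le> 1" if "i < N" for i
    proof -
      have "D = D'" if "D \<in> {D\<in>\<D> i. x \<in> D}" "D' \<in> {D\<in>\<D> i. x \<in> D}" for D D'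
      proof -
        from that obtain A B A' B' where D: "A \<in> U i" "B \<in> V i" "D = A \<inter> B" "x \<in> A" "x \<in> B"
          "A' \<in> U i" "B' \<in> V i" "D' = A' \<inter> B'" "x \<in> A'" "x \<in> B'"
          by (auto simp: \<D>_def)
        then have "A = A'" "B = B'"
          using U[OF \<open>i < N\<close>] V[OF \<open>i < N\<close>]
          unfolding disjoint_refining_def pairwise_def disjnt_def by blast+
        then show ?thesis using D by simp
      qed
      then show ?thesis using fin_\<D>[OF that] by (simp add: card_le_Suc0_iff_eq)
    qed
    have "card {D\<in>(\<Union>i<N. \<D> i). x \<in> D} = card (\<Union>i<N. {D\<in>\<D> i. x \<in> D})"
      by (intro arg_cong[where f=card]) auto
    also have "\<dots> \<le> (\<Sum>i<N. card {D\<in>\<D> i. x \<in> D})"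
      by (intro card_UN_le) auto
    also have "\<dots> \<le> (\<Sum>i<N. 1)" using one by (intro sum_mono) auto
    finally show "card {D\<in>(\<Union>i<N. \<D> i). x \<in> D} \<le> N" by simp
  qed
  then show ?thesis using p q by (simp add: N_def)
qed

section \<open>Existence of the growth rate of a cover\<close>

text \<open>
  Fekete's lemma: the limit is the infimum \<open>L\<close> of \<open>a n / n\<close> over \<open>n \<ge> 1\<close>. If \<open>a m / m\<close> is close to
  \<open>L\<close>, dividing \<open>n\<close> by \<open>m\<close> with remainder bounds \<open>a n / n\<close> by \<open>a m / m\<close> plus a term \<open>M / n\<close>
  that comes from the finitely many remainders.
\<close>

lemma convergent_subadditive:
  fixes a :: "nat \<Rightarrow> real"
  assumes sub: "\<And>m n. a (m + n) \<le> a m + a n" and nonneg: "\<And>n. 0 \<le> a n"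
  shows "convergent (\<lambda>n. 1 / real n * a n)"
proof -
  define L where "L = (INF n\<in>{1..}. a n / real n)"
  have bdd: "bdd_below ((\<lambda>n. a n / real n) ` {1..})"
    using nonneg by (intro bdd_belowI[of _ 0]) auto
  have lower: "L \<le> a n / real n" if "1 \<le> n" for n
    unfolding L_def using that by (intro cINF_lower bdd) auto
  have "(\<lambda>n. 1 / real n * a n) \<longlonglongrightarrow> L"
  proof (rule LIMSEQ_I)
    fix r :: real assume "r > 0"
    then have "(INF n\<in>{1..}. a n / real n) < L + r / 2"
      unfolding L_def by simp
    then have "\<exists>m\<in>{1..}. a m / real m < L + r / 2"
      by (subst (asm) cINF_less_iff[OF _ bdd]) auto
    then obtain m where m: "1 \<le> m" "a m / real m < L + r / 2"
      by auto
    define M where "M = Max (a ` {..<m})"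
    have M: "a k \<le> M" if "k < m" for k
      using that by (auto simp: M_def)
    have mult: "a (q * m + k) \<le> real q * a m + a k" for q k
    proof (induction q)
      case (Suc q)
      have "a (Suc q * m + k) \<le> a m + a (q * m + k)"
        using sub[of m "q * m + k"] by (simp add: algebra_simps)
      with Suc show ?case by (simp add: algebra_simps)
    qed simp
    obtain N where N: "2 * M / r < real N"
      using reals_Archimedean2 by blast
    have "norm (1 / real n * a n - L) < r" if n: "n \<ge> max N 1" for n
    proof -
      have "real (n div m) * real m \<le> real n"
        by (metis div_times_less_eq_dividend of_nat_le_iff of_nat_mult)
      then have div_le: "real (n div m) \<le> real n / real m"
        using m by (simp add: field_simps)
      have "a n \<le> real (n div m) * a m + a (n mod m)"
        using mult[of "n div m" "n mod m"] by simp
      also have "\<dots> \<le> real n / real m * a m + M"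
        using M[of "n mod m"] m nonneg[of m] div_le
        by (intro add_mono mult_right_mono) auto
      finally have "a n / real n \<le> (real n / real m * a m + M) / real n"
        by (simp add: divide_right_mono)
      also have "\<dots> = a m / real m + M / real n"
        using n by (simp add: field_simps)
      also have "M / real n < r / 2"
      proof -
        have "2 * M / r < real n" using N n by linarith
        then show ?thesis using \<open>r > 0\<close> n by (simp add: field_simps)
      qed
      finally have "a n / real n < L + r"
        using m by simp
      moreover have "L \<le> a n / real n" using lower n by simp
      ultimately show ?thesis using \<open>r > 0\<close> by (simp add: abs_less_iff)
    qed
    then show "\<exists>no. \<forall>n\<ge>no. norm (1 / real n * a n - L) < r" by blast
  qed
  then show ?thesis by (rule convergentI)
qed

definition iterated_join :: "'a topology \<Rightarrow> ('a \<Rightarrow> 'a) \<Rightarrow> 'a set set \<Rightarrow> nat \<Rightarrow> 'a set set" where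
  "iterated_join X T \<alpha> n = join_covers X {0..<n} (\<lambda>i. preimage_cover X (T ^^ i) \<alpha>)"

definition growth_rate :: "'a topology \<Rightarrow> ('a \<Rightarrow> 'a) \<Rightarrow> 'a set set \<Rightarrow> real" where
  "growth_rate X T \<alpha> =
     lim (\<lambda>n. 1 / real n * real_of_int (cover_dim X (iterated_join X T \<alpha> n)))"

lemma mdim_eq_SUP_growth_rate:
  "mdim X T = (SUP \<alpha>\<in>{\<alpha>. finite_open_cover X \<alpha>}. ereal (growth_rate X T \<alpha>))"
  by (simp add: mdim_def growth_rate_def iterated_join_def)

text \<open>
  Prescribing the sets that the first \<open>n\<close> points of an orbit visit gives the typical member of an
  iterated join, in a form where pullbacks and shifts of the time index are easy to compute.
\<close>

definition itinerary_set :: "'a topology \<Rightarrow> ('a \<Rightarrow> 'a) \<Rightarrow> nat \<Rightarrow> (nat \<Rightarrow> 'a set) \<Rightarrow> 'a set" where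
  "itinerary_set X T n U = {x\<in>topspace X. \<forall>i<n. (T ^^ i) x \<in> U i}"

lemma iterated_join_eq:
  "iterated_join X T \<alpha> n = {itinerary_set X T n U | U. \<forall>i<n. U i \<in> \<alpha>}"
proof (intro equalityI subsetI)
  fix A assume "A \<in> iterated_join X T \<alpha> n"
  then obtain V where V: "\<forall>i\<in>{0..<n}. V i \<in> preimage_cover X (T ^^ i) \<alpha>"
    and A: "A = topspace X \<inter> (\<Inter>i\<in>{0..<n}. V i)"
    unfolding iterated_join_def join_covers_def by blast
  have "\<exists>U. U \<in> \<alpha> \<and> V i = (T ^^ i) -` U \<inter> topspace X" if "i < n" for i
  proof -
    have "V i \<in> preimage_cover X (T ^^ i) \<alpha>" using V that by simp
    then show ?thesis unfolding preimage_cover_def by blast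
  qed
  then obtain U where U: "\<And>i. i < n \<Longrightarrow> U i \<in> \<alpha> \<and> V i = (T ^^ i) -` U i \<inter> topspace X"
    by metis
  then have "A = itinerary_set X T n U"
    unfolding A itinerary_set_def by auto
  then show "A \<in> {itinerary_set X T n U | U. \<forall>i<n. U i \<in> \<alpha>}"
    using U by blast
next
  fix A assume "A \<in> {itinerary_set X T n U | U. \<forall>i<n. U i \<in> \<alpha>}"
  then obtain U where U: "\<forall>i<n. U i \<in> \<alpha>" "A = itinerary_set X T n U" by blast
  have "A = topspace X \<inter> (\<Inter>i\<in>{0..<n}. (T ^^ i) -` U i \<inter> topspace X)"
    unfolding U(2) itinerary_set_def by auto
  moreover have "\<forall>i\<in>{0..<n}. (T ^^ i) -` U i \<inter> topspace X \<in> preimage_cover X (T ^^ i) \<alpha>"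
    using U(1) by (auto simp: preimage_cover_def)
  ultimately show "A \<in> iterated_join X T \<alpha> n"
    unfolding iterated_join_def join_covers_def mem_Collect_eq
    by (intro exI[of _ "\<lambda>i. (T ^^ i) -` U i \<inter> topspace X"] conjI)
qed

lemma continuous_map_funpow:
  assumes "continuous_map X X T"
  shows "continuous_map X X (T ^^ n)"
proof (induction n)
  case (Suc n)
  then show ?case using assms continuous_map_compose by (simp only: funpow.simps) blast
qed (simp add: id_def)

lemma finite_open_cover_iterated_join:
  assumes T: "continuous_map X X T" and \<alpha>: "finite_open_cover X \<alpha>"
  shows "finite_open_cover X (iterated_join X T \<alpha> n)"
  unfolding finite_open_cover_def
proof (intro conjI ballI)
  have "iterated_join X T \<alpha> n \<subseteq> itinerary_set X T n ` PiE {..<n} (\<lambda>_. \<alpha>)"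
  proof
    fix A assume "A \<in> iterated_join X T \<alpha> n"
    then obtain U where "\<forall>i<n. U i \<in> \<alpha>" "A = itinerary_set X T n U"
      by (auto simp: iterated_join_eq)
    then have "A = itinerary_set X T n (restrict U {..<n})"
        "restrict U {..<n} \<in> PiE {..<n} (\<lambda>_. \<alpha>)"
      by (auto simp: itinerary_set_def)
    then show "A \<in> itinerary_set X T n ` PiE {..<n} (\<lambda>_. \<alpha>)" by blast
  qed
  then show "finite (iterated_join X T \<alpha> n)"
    using \<alpha> by (rule_tac finite_subset) (auto simp: finite_open_cover_def intro: finite_PiE)
next
  fix A assume "A \<in> iterated_join X T \<alpha> n"
  then obtain U where U: "\<forall>i<n. U i \<in> \<alpha>" "A = itinerary_set X T n U"
    by (auto simp: iterated_join_eq)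
  have "A = (\<Inter>i\<in>{..<n}. (T ^^ i) -` U i \<inter> topspace X) \<inter> topspace X"
    unfolding U(2) itinerary_set_def by auto
  also have "openin X \<dots>"
    using U(1) \<alpha> continuous_map_funpow[OF T]
    by (intro openin_INT openin_vimage) (auto simp: finite_open_cover_def)
  finally show "openin X A" .
next
  have "x \<in> \<Union>(iterated_join X T \<alpha> n)" if x: "x \<in> topspace X" for x
  proof -
    have "\<exists>U\<in>\<alpha>. (T ^^ i) x \<in> U" for i
      using continuous_map_image_subset_topspace[OF continuous_map_funpow[OF T], of i] x \<alpha>
      by (fastforce simp: finite_open_cover_def)
    then obtain U where "\<And>i. U i \<in> \<alpha> \<and> (T ^^ i) x \<in> U i" by metis
    then show ?thesis
      using x by (auto simp: iterated_join_eq itinerary_set_def)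
  qed
  then show "\<Union>(iterated_join X T \<alpha> n) = topspace X"
    by (auto simp: iterated_join_eq itinerary_set_def)
qed

lemma finite_open_cover_preimage_cover:
  assumes f: "continuous_map X X f" and \<alpha>: "finite_open_cover X \<alpha>"
  shows "finite_open_cover X (preimage_cover X f \<alpha>)"
  using openin_vimage[OF f] continuous_map_image_subset_topspace[OF f] \<alpha>
  by (fastforce simp: finite_open_cover_def preimage_cover_def)

lemma cover_dim_iterated_join_subadditive:
  assumes "normal_space X" and "topspace X \<noteq> {}"
    and T: "continuous_map X X T" and \<alpha>: "finite_open_cover X \<alpha>"
  shows "cover_dim X (iterated_join X T \<alpha> (m + n)) \<le>
    cover_dim X (iterated_join X T \<alpha> m) + cover_dim X (iterated_join X T \<alpha> n)"
proof -
  let ?J = "iterated_join X T \<alpha>" and ?P = "preimage_cover X (T ^^ m) (iterated_join X T \<alpha> n)"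
  note Tm = continuous_map_funpow[OF T, of m]
  note foc = finite_open_cover_iterated_join[OF T \<alpha>]
  have "\<exists>C\<in>?J (m + n). A \<inter> B \<subseteq> C" if "A \<in> ?J m" "B \<in> ?P" for A B
  proof -
    obtain U where U: "\<forall>i<m. U i \<in> \<alpha>" "A = itinerary_set X T m U"
      using \<open>A \<in> ?J m\<close> by (auto simp: iterated_join_eq)
    obtain V where V: "\<forall>i<n. V i \<in> \<alpha>" "B = (T ^^ m) -` itinerary_set X T n V \<inter> topspace X"
      using \<open>B \<in> ?P\<close> by (auto simp: iterated_join_eq preimage_cover_def)
    define W where "W i = (if i < m then U i else V (i - m))" for i
    have "(T ^^ i) x \<in> W i" if "x \<in> A \<inter> B" "i < m + n" for x i
    proof (cases "i < m")
      case True
      then show ?thesis using that U by (simp add: W_def itinerary_set_def)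
    next
      case False
      then have "(T ^^ i) x = (T ^^ (i - m)) ((T ^^ m) x)"
        by (metis funpow_add comp_apply le_add_diff_inverse2 not_less)
      then show ?thesis using that V False by (auto simp: W_def itinerary_set_def)
    qed
    then have "A \<inter> B \<subseteq> itinerary_set X T (m + n) W"
      using U by (auto simp: itinerary_set_def)
    moreover have "\<forall>i<m + n. W i \<in> \<alpha>"
      using U V by (auto simp: W_def)
    ultimately show ?thesis
      unfolding iterated_join_eq by blast
  qed
  then have "cover_dim X (?J (m + n)) \<le> cover_dim X (?J m) + cover_dim X ?P"
    using assms foc finite_open_cover_preimage_cover[OF Tm foc]
    by (intro cover_dim_subadditive) auto
  also have "cover_dim X ?P \<le> cover_dim X (?J n)"
    by (rule cover_dim_le_continuous_preimage[OF Tm foc]) (auto simp: preimage_cover_def)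
  finally show ?thesis by simp
qed

text \<open>
  Subadditivity needs a nonempty space; on the empty space the sequence is \<open>-1 / n\<close>.
\<close>

lemma growth_rate_limit:
  assumes "normal_space X" and T: "continuous_map X X T" and \<alpha>: "finite_open_cover X \<alpha>"
  shows "(\<lambda>n. 1 / real n * real_of_int (cover_dim X (iterated_join X T \<alpha> n)))
    \<longlonglongrightarrow> growth_rate X T \<alpha>"
proof -
  note foc = finite_open_cover_iterated_join[OF T \<alpha>]
  have "convergent (\<lambda>n. 1 / real n * real_of_int (cover_dim X (iterated_join X T \<alpha> n)))"
  proof (cases "topspace X = {}")
    case True
    have "(\<lambda>n. 1 / real n * (-1)) \<longlonglongrightarrow> 0" by (rule tendsto_mult_left_zero[OF lim_1_over_n])
    then show ?thesis
      using cover_dim_empty[OF foc True] by (auto intro: convergentI)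
  next
    case False
    show ?thesis
    proof (rule convergent_subadditive)
      show "real_of_int (cover_dim X (iterated_join X T \<alpha> (m + n))) \<le>
          real_of_int (cover_dim X (iterated_join X T \<alpha> m)) +
          real_of_int (cover_dim X (iterated_join X T \<alpha> n))" for m n
        using cover_dim_iterated_join_subadditive[OF assms(1) False T \<alpha>, of m n] by linarith
      show "0 \<le> real_of_int (cover_dim X (iterated_join X T \<alpha> n))" for n
        using cover_dim_nonneg[OF foc False] by simp
    qed
  qed
  then show ?thesis by (simp add: growth_rate_def convergent_LIMSEQ_iff)
qed

lemma growth_rate_nonneg:
  assumes "normal_space X" and T: "continuous_map X X T" and \<alpha>: "finite_open_cover X \<alpha>"
  shows "0 \<le> growth_rate X T \<alpha>"
proof (rule LIMSEQ_le[OF _ growth_rate_limit[OF assms]])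
  show "(\<lambda>n. 1 / real n * (-1)) \<longlonglongrightarrow> 0" by (rule tendsto_mult_left_zero[OF lim_1_over_n])
  have "-1 \<le> real_of_int (cover_dim X (iterated_join X T \<alpha> n))" for n
    using cover_dim_ge_minus_1[OF finite_open_cover_iterated_join[OF T \<alpha>], of n] by linarith
  then show "\<exists>N. \<forall>n\<ge>N. 1 / real n * (-1) \<le>
      1 / real n * real_of_int (cover_dim X (iterated_join X T \<alpha> n))"
    by (intro exI allI impI mult_left_mono) auto
qed

lemma growth_rate_empty:
  assumes T: "continuous_map X X T" and \<alpha>: "finite_open_cover X \<alpha>" and "topspace X = {}"
  shows "growth_rate X T \<alpha> = 0"
proof -
  have "(\<lambda>n. 1 / real n * (-1)) \<longlonglongrightarrow> 0" by (rule tendsto_mult_left_zero[OF lim_1_over_n])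
  then show ?thesis
    using cover_dim_empty[OF finite_open_cover_iterated_join[OF T \<alpha>] assms(3)]
    by (simp add: growth_rate_def limI)
qed

text \<open>
  If \<open>C i\<close> contains the pullback of \<open>U i\<close> for each \<open>i\<close>, then the orbits in \<open>Y\<close> whose images visit
  the sets \<open>U i\<close> visit the sets \<open>C i\<close>. Hence the pullback of each iterated join of \<open>\<alpha>\<close> refines
  that of \<open>\<gamma>\<close>, and the dimensions compare before the limit is taken.
\<close>

lemma growth_rate_le_of_semiconjugacy:
  assumes X: "normal_space X" "continuous_map X X T" "finite_open_cover X \<alpha>"
    and Y: "normal_space Y" "continuous_map Y Y S" "finite_open_cover Y \<gamma>"
    and \<pi>: "continuous_map Y X \<pi>" and semi: "\<And>y. y \<in> topspace Y \<Longrightarrow> \<pi> (S y) = T (\<pi> y)"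
    and fin: "\<And>A. A \<in> \<alpha> \<Longrightarrow> \<exists>C\<in>\<gamma>. \<pi> -` A \<inter> topspace Y \<subseteq> C"
  shows "growth_rate Y S \<gamma> \<le> growth_rate X T \<alpha>"
proof (rule LIMSEQ_le[OF growth_rate_limit[OF Y] growth_rate_limit[OF X]])
  have iter: "(S ^^ i) y \<in> topspace Y \<and> \<pi> ((S ^^ i) y) = (T ^^ i) (\<pi> y)"
    if "y \<in> topspace Y" for i y
    using that semi continuous_map_image_subset_topspace[OF Y(2)] by (induction i) auto
  have "cover_dim Y (iterated_join Y S \<gamma> n) \<le> cover_dim X (iterated_join X T \<alpha> n)" for n
  proof (rule cover_dim_le_continuous_preimage[OF \<pi> finite_open_cover_iterated_join[OF X(2,3)]])
    fix A assume "A \<in> iterated_join X T \<alpha> n"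
    then obtain U where U: "\<forall>i<n. U i \<in> \<alpha>" "A = itinerary_set X T n U"
      by (auto simp: iterated_join_eq)
    have "\<forall>i. \<exists>C. i < n \<longrightarrow> C \<in> \<gamma> \<and> \<pi> -` U i \<inter> topspace Y \<subseteq> C"
      using fin U(1) by blast
    then obtain C where C: "\<And>i. i < n \<Longrightarrow> C i \<in> \<gamma> \<and> \<pi> -` U i \<inter> topspace Y \<subseteq> C i"
      by metis
    have "(S ^^ i) y \<in> C i" if "y \<in> \<pi> -` A \<inter> topspace Y" "i < n" for y i
      using C[OF that(2)] iter[of y i] that U(2) by (auto simp: itinerary_set_def)
    then have "\<pi> -` A \<inter> topspace Y \<subseteq> itinerary_set Y S n C"
      by (auto simp: itinerary_set_def)
    then show "\<exists>B\<in>iterated_join Y S \<gamma> n. \<pi> -` A \<inter> topspace Y \<subseteq> B"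
      unfolding iterated_join_eq using C by blast
  qed
  then show "\<exists>N. \<forall>n\<ge>N. 1 / real n * real_of_int (cover_dim Y (iterated_join Y S \<gamma> n)) \<le>
      1 / real n * real_of_int (cover_dim X (iterated_join X T \<alpha> n))"
    by (intro exI allI impI mult_left_mono) auto
qed

section \<open>The natural extension as an inverse limit\<close>

lemma natural_ext_set_subset_topspace:
  "natural_ext_set X T \<subseteq> topspace (product_topology (\<lambda>_. X) UNIV)"
proof
  fix x assume "x \<in> natural_ext_set X T"
  then have "x k \<in> (T ^^ 0) ` topspace X" for k
    unfolding natural_ext_set_def by blast
  then show "x \<in> topspace (product_topology (\<lambda>_. X) UNIV)" by (simp add: PiE_iff)
qed

lemma topspace_natural_ext: "topspace (natural_ext X T) = natural_ext_set X T"
  using natural_ext_set_subset_topspace[of X T] by (auto simp: natural_ext_def)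

lemma continuous_map_natural_ext_projection:
  "continuous_map (natural_ext X T) X (\<lambda>x. x k)"
  unfolding natural_ext_def
  by (intro continuous_map_from_subtopology continuous_map_product_projection) simp

lemma natural_ext_funpow:
  assumes "x \<in> natural_ext_set X T"
  shows "(T ^^ i) (x (i + k)) = x k"
proof (induction i arbitrary: k)
  case (Suc i)
  have "(T ^^ Suc i) (x (Suc i + k)) = T ((T ^^ i) (x (i + Suc k)))" by simp
  also have "\<dots> = T (x (Suc k))" using Suc.IH[of "Suc k"] by simp
  also have "\<dots> = x k" using assms by (simp add: natural_ext_set_def)
  finally show ?case .
qed simp

lemma continuous_map_natural_ext_map:
  assumes T: "continuous_map X X T"
  shows "continuous_map (natural_ext X T) (natural_ext X T) (natural_ext_map T)"
proof -
  have "continuous_map (natural_ext X T) X (\<lambda>x. natural_ext_map T x k)" for k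
  proof (cases k)
    case 0
    then show ?thesis
      using continuous_map_compose[OF continuous_map_natural_ext_projection[of X T 0] T]
      by (simp add: natural_ext_map_def comp_def)
  next
    case (Suc j)
    then show ?thesis
      using continuous_map_natural_ext_projection[of X T j] by (simp add: natural_ext_map_def)
  qed
  then have "continuous_map (natural_ext X T) (product_topology (\<lambda>_. X) UNIV) (natural_ext_map T)"
    by (simp add: continuous_map_componentwise_UNIV)
  moreover have "natural_ext_map T x \<in> natural_ext_set X T" if x: "x \<in> natural_ext_set X T" for x
  proof -
    have "T (x 0) \<in> (T ^^ n) ` topspace X" for n
    proof -
      obtain y where y: "y \<in> topspace X" "x 0 = (T ^^ n) y"
        using x unfolding natural_ext_set_def by blast
      then have "T (x 0) = (T ^^ n) (T y)" by (simp add: funpow_swap1)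
      moreover have "T y \<in> topspace X"
        using y continuous_map_image_subset_topspace[OF T] by blast
      ultimately show ?thesis by blast
    qed
    then show ?thesis
      using x by (auto simp: natural_ext_set_def natural_ext_map_def split: nat.split)
  qed
  ultimately have "continuous_map (natural_ext X T)
      (subtopology (product_topology (\<lambda>_. X) UNIV) (natural_ext_set X T)) (natural_ext_map T)"
    by (intro continuous_map_into_subtopology) (auto simp: topspace_natural_ext)
  then show ?thesis by (simp add: natural_ext_def)
qed

text \<open>
  The conditions that define the natural extension are closed in the product: the images
  \<open>(T ^^ n) ` topspace X\<close> are compact, hence closed, and the equations \<open>T (x (Suc k)) = x k\<close> compare
  continuous maps into a Hausdorff space.
\<close>

lemma compact_Hausdorff_natural_ext:
  assumes "compact_space X" and "Hausdorff_space X" and T: "continuous_map X X T"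
  shows "compact_space (natural_ext X T)" and "Hausdorff_space (natural_ext X T)"
proof -
  let ?P = "product_topology (\<lambda>_::nat. X) UNIV"
  have proj: "continuous_map ?P X (\<lambda>x. x k)" for k
    by (intro continuous_map_product_projection) simp
  have "compact_space ?P" and Haus: "Hausdorff_space ?P"
    using assms by (auto simp: compact_space_product_topology Hausdorff_space_product_topology)
  have "closedin X ((T ^^ n) ` topspace X)" for n
    using assms continuous_map_funpow[OF T]
    by (intro compactin_imp_closedin image_compactin[of X]) (auto simp: compact_space_def)
  then have img: "closedin ?P {x\<in>topspace ?P. x k \<in> (T ^^ n) ` topspace X}" for k n
    by (rule closedin_continuous_map_preimage[OF proj])
  have fib: "closedin ?P {x\<in>topspace ?P. (T \<circ> (\<lambda>x. x (Suc k))) x = x k}" for k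
    by (rule closedin_continuous_maps_eq[OF assms(2) continuous_map_compose[OF proj T] proj])
  have "natural_ext_set X T =
      (\<Inter>k. (\<Inter>n. {x\<in>topspace ?P. x k \<in> (T ^^ n) ` topspace X}) \<inter>
        {x\<in>topspace ?P. (T \<circ> (\<lambda>x. x (Suc k))) x = x k})"
    using natural_ext_set_subset_topspace[of X T] by (auto simp: natural_ext_set_def)
  also have "closedin ?P \<dots>"
    using img fib by (intro closedin_INT closedin_Int) auto
  finally have "compactin ?P (natural_ext_set X T)"
    using \<open>compact_space ?P\<close> closedin_compact_space by blast
  then show "compact_space (natural_ext X T)"
    by (simp add: natural_ext_def compact_space_subtopology)
  show "Hausdorff_space (natural_ext X T)"
    using Haus by (simp add: natural_ext_def Hausdorff_space_subtopology)
qed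

text \<open>
  A basic neighbourhood constrains finitely many coordinates, say up to \<open>k\<close>. Since the coordinate
  \<open>i \<le> k\<close> is the image of the coordinate \<open>k\<close> under \<open>T ^^ (k - i)\<close>, all constraints can be moved to
  the coordinate \<open>k\<close>.
\<close>

lemma natural_ext_neighbourhood:
  assumes T: "continuous_map X X T" and C: "openin (natural_ext X T) C" and "x \<in> C"
  shows "\<exists>k U. openin X U \<and> x k \<in> U \<and> {y\<in>natural_ext_set X T. y k \<in> U} \<subseteq> C"
proof -
  have xN: "x \<in> natural_ext_set X T"
    using openin_subset[OF C] \<open>x \<in> C\<close> by (auto simp: topspace_natural_ext)
  obtain D where D: "openin (product_topology (\<lambda>_. X) UNIV) D" "C = D \<inter> natural_ext_set X T"
    using C by (auto simp: natural_ext_def openin_subtopology)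
  then obtain V where V: "finite {i. V i \<noteq> topspace X}" "\<And>i. openin X (V i)"
      "\<And>i. x i \<in> V i" "PiE UNIV V \<subseteq> D"
    using \<open>x \<in> C\<close> unfolding openin_product_topology_alt by (fastforce simp: PiE_iff)
  obtain k where k: "\<And>i. V i \<noteq> topspace X \<Longrightarrow> i \<le> k"
    using V(1) by (auto simp: finite_nat_set_iff_bounded_le)
  define U where "U = (\<Inter>i\<in>{..k}. (T ^^ (k - i)) -` V i \<inter> topspace X) \<inter> topspace X"
  have top: "y i \<in> topspace X" if "y \<in> natural_ext_set X T" for y i
    using natural_ext_set_subset_topspace[of X T] that by auto
  have shift: "(T ^^ (k - i)) (y k) = y i" if "y \<in> natural_ext_set X T" "i \<le> k" for y i
    using natural_ext_funpow[OF that(1), of "k - i" i] that(2) by simp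
  have "openin X U"
    unfolding U_def using V(2) continuous_map_funpow[OF T]
    by (intro openin_INT openin_vimage) auto
  moreover have "x k \<in> U"
    using xN V(3) by (auto simp: U_def shift top)
  moreover have "y \<in> C" if "y \<in> natural_ext_set X T" "y k \<in> U" for y
  proof -
    have "y i \<in> V i" for i
    proof (cases "i \<le> k")
      case True
      then have "(T ^^ (k - i)) (y k) \<in> V i" using that(2) by (auto simp: U_def)
      then show ?thesis by (simp add: shift[OF that(1) True])
    next
      case False
      then show ?thesis using k top[OF that(1)] by blast
    qed
    then show ?thesis using V(4) D(2) that(1) by (auto simp: PiE_iff)
  qed
  ultimately show ?thesis by blast
qed

text \<open>
  The natural extension is assumed nonempty because the complement of the image of the coordinate
  map has empty pullback, and even the empty set must find a member of \<open>\<gamma>\<close> to lie in.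
\<close>

lemma natural_ext_cover_refined_by_pullback:
  assumes "compact_space X" and "Hausdorff_space X" and T: "continuous_map X X T"
    and \<gamma>: "finite_open_cover (natural_ext X T) \<gamma>" and ne: "natural_ext_set X T \<noteq> {}"
  shows "\<exists>m \<alpha>. finite_open_cover X \<alpha> \<and>
    (\<forall>A\<in>\<alpha>. \<exists>C\<in>\<gamma>. (\<lambda>x. x m) -` A \<inter> natural_ext_set X T \<subseteq> C)"
proof -
  let ?N = "natural_ext_set X T" and ?E = "natural_ext X T"
  have cE: "compact_space ?E"
    using compact_Hausdorff_natural_ext[OF assms(1-3)] by blast
  have \<gamma>_cov: "\<Union>\<gamma> = ?N"
    using \<gamma> by (simp add: finite_open_cover_def topspace_natural_ext)
  define cyl where "cyl k U = {y\<in>?N. y k \<in> U}" for k :: nat and U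
  have "\<exists>k U. openin X U \<and> x k \<in> U \<and> (\<exists>C\<in>\<gamma>. cyl k U \<subseteq> C)" if x: "x \<in> ?N" for x
  proof -
    obtain C where "C \<in> \<gamma>" "x \<in> C" using x \<gamma>_cov by blast
    moreover from this have "openin ?E C" using \<gamma> by (auto simp: finite_open_cover_def)
    ultimately show ?thesis
      unfolding cyl_def using natural_ext_neighbourhood[OF T, of C x] by blast
  qed
  then obtain k U where kU: "\<And>x. x \<in> ?N \<Longrightarrow> openin X (U x)" "\<And>x. x \<in> ?N \<Longrightarrow> x (k x) \<in> U x"
    "\<And>x. x \<in> ?N \<Longrightarrow> \<exists>C\<in>\<gamma>. cyl (k x) (U x) \<subseteq> C"
    by metis
  define nbhd where "nbhd x = cyl (k x) (U x)" for x
  have "\<forall>V\<in>nbhd ` ?N. openin ?E V"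
    using openin_continuous_map_preimage[OF continuous_map_natural_ext_projection[of X T]] kU(1)
    by (auto simp: nbhd_def cyl_def topspace_natural_ext)
  moreover have "topspace ?E \<subseteq> \<Union>(nbhd ` ?N)"
    using kU(2) by (auto simp: nbhd_def cyl_def topspace_natural_ext)
  ultimately obtain \<F> where \<F>: "finite \<F>" "\<F> \<subseteq> nbhd ` ?N" "topspace ?E \<subseteq> \<Union>\<F>"
    using cE unfolding compact_space_alt by meson
  then obtain F where F: "F \<subseteq> ?N" "finite F" "\<F> = nbhd ` F"
    by (meson finite_subset_image)
  \<comment> \<open>All constraints are moved to the latest of the finitely many coordinates involved.\<close>
  define m where "m = Max (k ` F)"
  have m: "k x \<le> m" if "x \<in> F" for x
    using F(2) that by (simp add: m_def)
  define A where "A x = (T ^^ (m - k x)) -` U x \<inter> topspace X" for x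
  have A: "y m \<in> A x \<longleftrightarrow> y \<in> nbhd x" if "x \<in> F" "y \<in> ?N" for x y
    using natural_ext_funpow[OF that(2), of "m - k x" "k x"] m[OF that(1)] that(2)
      natural_ext_set_subset_topspace[of X T]
    by (auto simp: A_def nbhd_def cyl_def)
  define K where "K = (\<lambda>x. x m) ` ?N"
  define \<alpha> where "\<alpha> = insert (topspace X - K) (A ` F)"
  show ?thesis
  proof (intro exI[of _ m] exI[of _ \<alpha>] conjI ballI)
    have "compactin X K"
      unfolding K_def topspace_natural_ext[symmetric]
      using cE continuous_map_natural_ext_projection
      by (intro image_compactin[of ?E]) (auto simp: compact_space_def)
    then have "openin X (topspace X - K)"
      using assms(2) compactin_imp_closedin by blast
    moreover have "openin X (A x)" if "x \<in> F" for x
      unfolding A_def using kU(1) F(1) that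
      by (intro openin_vimage[OF continuous_map_funpow[OF T]]) auto
    moreover have "K \<subseteq> \<Union>(A ` F)"
    proof
      fix z assume "z \<in> K"
      then obtain y where y: "y \<in> ?N" "z = y m" by (auto simp: K_def)
      then obtain x where "x \<in> F" "y \<in> nbhd x"
        using \<F>(3) F(3) by (auto simp: topspace_natural_ext)
      then show "z \<in> \<Union>(A ` F)" using A y by auto
    qed
    ultimately show "finite_open_cover X \<alpha>"
      using F(2) by (auto simp: finite_open_cover_def \<alpha>_def dest: openin_subset)
  next
    fix B assume "B \<in> \<alpha>"
    then consider "B = topspace X - K" | x where "x \<in> F" "B = A x"
      by (auto simp: \<alpha>_def)
    then show "\<exists>C\<in>\<gamma>. (\<lambda>x. x m) -` B \<inter> ?N \<subseteq> C"
    proof cases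
      case 1
      then have "(\<lambda>x. x m) -` B \<inter> ?N = {}" by (auto simp: K_def)
      moreover have "\<gamma> \<noteq> {}" using \<gamma>_cov ne by auto
      ultimately show ?thesis by auto
    next
      case 2
      then have "(\<lambda>x. x m) -` B \<inter> ?N \<subseteq> nbhd x" using A by auto
      moreover obtain C where "C \<in> \<gamma>" "nbhd x \<subseteq> C"
        unfolding nbhd_def using kU(3)[of x] F(1) 2(1) by blast
      ultimately show ?thesis by blast
    qed
  qed
qed

theorem proposition3p5:
  fixes X :: "'a topology" and T :: "'a \<Rightarrow> 'a"
  assumes "compact_space X" and "metrizable_space X" and "continuous_map X X T"
  shows "mdim X T \<ge> mdim (natural_ext X T) (natural_ext_map T)"
proof -
  let ?E = "natural_ext X T" and ?S = "natural_ext_map T"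
  have "Hausdorff_space X"
    using assms(2) by (rule metrizable_imp_Hausdorff_space)
  then have "compact_space ?E" "Hausdorff_space ?E"
    using assms by (auto intro: compact_Hausdorff_natural_ext)
  then have nX: "normal_space X" and nE: "normal_space ?E"
    using assms(1) \<open>Hausdorff_space X\<close> compact_Hausdorff_or_regular_imp_normal_space by blast+
  have S: "continuous_map ?E ?E ?S"
    using assms(3) by (rule continuous_map_natural_ext_map)
  have "\<exists>\<alpha>. finite_open_cover X \<alpha> \<and> growth_rate ?E ?S \<gamma> \<le> growth_rate X T \<alpha>"
    if \<gamma>: "finite_open_cover ?E \<gamma>" for \<gamma>
  proof (cases "natural_ext_set X T = {}")
    case True
    \<comment> \<open>All growth rates on the empty space vanish, and those on \<open>X\<close> are nonnegative.\<close>
    have "finite_open_cover X {topspace X}" by (simp add: finite_open_cover_def)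
    moreover have "growth_rate ?E ?S \<gamma> = 0"
      using growth_rate_empty[OF S \<gamma>] True by (simp add: topspace_natural_ext)
    ultimately show ?thesis
      using growth_rate_nonneg[OF nX assms(3)] by metis
  next
    case False
    obtain m \<alpha> where \<alpha>: "finite_open_cover X \<alpha>"
      "\<forall>A\<in>\<alpha>. \<exists>C\<in>\<gamma>. (\<lambda>x. x m) -` A \<inter> natural_ext_set X T \<subseteq> C"
      using natural_ext_cover_refined_by_pullback
        [OF assms(1) \<open>Hausdorff_space X\<close> assms(3) \<gamma> False] by (elim exE conjE)
    have "?S x m = T (x m)" if "x \<in> topspace ?E" for x
      using that by (cases m) (auto simp: topspace_natural_ext natural_ext_set_def natural_ext_map_def)
    then have "growth_rate ?E ?S \<gamma> \<le> growth_rate X T \<alpha>"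
      using \<alpha>(2) by (intro growth_rate_le_of_semiconjugacy[OF nX assms(3) \<alpha>(1) nE S \<gamma>
        continuous_map_natural_ext_projection[of X T m]]) (auto simp: topspace_natural_ext)
    with \<alpha>(1) show ?thesis by blast
  qed
  then show ?thesis
    unfolding mdim_eq_SUP_growth_rate by (intro SUP_mono) auto
qed

end
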